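(* Let $P$ and $T$ be strings of lengths $m$ and $n$, respectively. Suppose we are given a solution to the LCE problem on $P$ (a data structure answering $\mathrm{LCE}_P$ queries) using $s(m)$ space and $q(m)$ query time, and let $\tau$ be a parameter with $1 \leq \tau \leq n$. Then the LCE problem on $P$ and $T$ (answering $\mathrm{LCE}_{P,T}(i,j)$ queries) can be solved using $O(n/\tau + s(m))$ space and $O(\tau + q(m))$ query time.
   Context: For a single string $P$, $\mathrm{LCE}_P(i,j)$ is the length of the longest common prefix of the suffixes of $P$ starting at positions $i$ and $j$. For two strings $P$ and $T$, $\mathrm{LCE}_{P,T}(i,j)$ is the length of the longest common prefix of the suffix of $P$ starting at position $i$ and the suffix of $T$ starting at position $j$. The LCE problem is to preprocess the input into a data structure supporting such queries. The input strings are in read-only memory and are not counted in the space; space is measured in machine words. *)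

theory Defs
  imports Complex_Main "HOL-Library.Sublist"
begin

definition LCE2 :: "'a list \<Rightarrow> 'a list \<Rightarrow> nat \<Rightarrow> nat \<Rightarrow> nat" where
  "LCE2 P T i j = length (longest_common_prefix (drop i P) (drop j T))"

definition LCE1 :: "'a list \<Rightarrow> nat \<Rightarrow> nat \<Rightarrow> nat" where
  "LCE1 P i j = length (longest_common_prefix (drop i P) (drop j P))"

text \<open>
  The model of computation is the unit-cost word RAM with word size \<open>w\<close>. Words are the natural
  numbers below \<open>2 ^ w\<close>, and arithmetic is modulo \<open>2 ^ w\<close>. A program uses finitely many registers
  and finitely many read-write arrays of words, each named by a number occurring literally in the
  program; cells inside an array are addressed by the contents of a register. The input strings
  are read-only arrays of words and can be accessed by a program, but not written.
\<close>

datatype binop = Add | Sub | Mult | Div | Mod | And | Or | Xor | Shl | Shr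

fun eval_binop :: "nat \<Rightarrow> binop \<Rightarrow> nat \<Rightarrow> nat \<Rightarrow> nat" where
  "eval_binop w Add x y = take_bit w (x + y)"
| "eval_binop w Sub x y = take_bit w (x + 2 ^ w - y)"
| "eval_binop w Mult x y = take_bit w (x * y)"
| "eval_binop w Div x y = take_bit w (x div y)"
| "eval_binop w Mod x y = take_bit w (x mod y)"
| "eval_binop w And x y = take_bit w (and x y)"
| "eval_binop w Or x y = take_bit w (or x y)"
| "eval_binop w Xor x y = take_bit w (xor x y)"
| "eval_binop w Shl x y = take_bit w (push_bit y x)"
| "eval_binop w Shr x y = take_bit w (drop_bit y x)"

datatype test = Less nat nat | Equal nat nat

type_synonym regs = "nat \<Rightarrow> nat"
type_synonym memory = "nat \<Rightarrow> nat list"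

fun eval_test :: "test \<Rightarrow> regs \<Rightarrow> bool" where
  "eval_test (Less a b) R = (R a < R b)"
| "eval_test (Equal a b) R = (R a = R b)"

text \<open>
  In \<open>InputLength r k\<close> and \<open>Input r k a\<close>, \<open>k\<close> is the number of an input string; in \<open>Load r k a\<close> and
  \<open>Store k a r\<close>, \<open>k\<close> is the number of an array. All other arguments of type \<^typ>\<open>nat\<close> are register
  numbers, except for the literal \<open>c\<close> in \<open>Const r c\<close>. The register \<open>a\<close> holds the address.
\<close>

datatype prog =
    Skip
  | Const nat nat
  | Move nat nat
  | Binop nat binop nat nat
  | InputLength nat nat
  | Input nat nat nat
  | Load nat nat nat
  | Store nat nat nat
  | Seq prog prog
  | If test prog prog
  | While test prog

text \<open>
  \<open>exec w I c R M t R' M'\<close>: on the input strings \<open>I\<close>, program \<open>c\<close> started with registers \<open>R\<close> and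
  memory \<open>M\<close> halts after exactly \<open>t\<close> unit-cost steps with registers \<open>R'\<close> and memory \<open>M'\<close>. There is no
  rule for an access outside the bounds of an array or of an input string, so that a program
  performing one does not halt. Array lengths never change, hence no memory is allocated by a
  running program.
\<close>

inductive exec :: "nat \<Rightarrow> nat list list \<Rightarrow> prog \<Rightarrow> regs \<Rightarrow> memory \<Rightarrow> nat \<Rightarrow> regs \<Rightarrow> memory \<Rightarrow> bool"
  for w :: nat and I :: "nat list list" where
  Skip: "exec w I Skip R M 1 R M"
| Const: "exec w I (Const r c) R M 1 (R(r := take_bit w c)) M"
| Move: "exec w I (Move r a) R M 1 (R(r := R a)) M"
| Binop: "exec w I (Binop r f a b) R M 1 (R(r := eval_binop w f (R a) (R b))) M"
| InputLength: "k < length I \<Longrightarrow>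
    exec w I (InputLength r k) R M 1 (R(r := length (I ! k))) M"
| Input: "k < length I \<Longrightarrow> R a < length (I ! k) \<Longrightarrow>
    exec w I (Input r k a) R M 1 (R(r := I ! k ! R a)) M"
| Load: "R a < length (M k) \<Longrightarrow>
    exec w I (Load r k a) R M 1 (R(r := M k ! R a)) M"
| Store: "R a < length (M k) \<Longrightarrow>
    exec w I (Store k a r) R M 1 R (M(k := (M k)[R a := R r]))"
| Seq: "exec w I c1 R M t1 R1 M1 \<Longrightarrow> exec w I c2 R1 M1 t2 R2 M2 \<Longrightarrow>
    exec w I (Seq c1 c2) R M (t1 + t2) R2 M2"
| IfTrue: "eval_test b R \<Longrightarrow> exec w I c1 R M t R1 M1 \<Longrightarrow>
    exec w I (If b c1 c2) R M (Suc t) R1 M1"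
| IfFalse: "\<not> eval_test b R \<Longrightarrow> exec w I c2 R M t R1 M1 \<Longrightarrow>
    exec w I (If b c1 c2) R M (Suc t) R1 M1"
| WhileFalse: "\<not> eval_test b R \<Longrightarrow> exec w I (While b c) R M 1 R M"
| WhileTrue: "eval_test b R \<Longrightarrow> exec w I c R M t1 R1 M1 \<Longrightarrow>
    exec w I (While b c) R1 M1 t2 R2 M2 \<Longrightarrow>
    exec w I (While b c) R M (Suc (t1 + t2)) R2 M2"

inductive_cases exec_elims:
  "exec w I Skip R M t R' M'"
  "exec w I (Const r c) R M t R' M'"
  "exec w I (Move r a) R M t R' M'"
  "exec w I (Binop r f a b) R M t R' M'"
  "exec w I (InputLength r k) R M t R' M'"
  "exec w I (Input r k a) R M t R' M'"
  "exec w I (Load r k a) R M t R' M'"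
  "exec w I (Store k a r) R M t R' M'"
  "exec w I (Seq c1 c2) R M t R' M'"
  "exec w I (If b c1 c2) R M t R' M'"

inductive_cases exec_WhileE: "exec w I (While b c) R M t R' M'"

lemma exec_deterministic:
  assumes "exec w I c R M t R1 M1" and "exec w I c R M u R2 M2"
  shows "t = u \<and> R1 = R2 \<and> M1 = M2"
  using assms
proof (induction arbitrary: u R2 M2 rule: exec.induct)
  case (Seq c1 R M t1 R1 M1 c2 t2 R2' M2')
  from Seq.prems obtain u1 u2 S N where u: "u = u1 + u2"
    and 1: "exec w I c1 R M u1 S N" and 2: "exec w I c2 S N u2 R2 M2"
    by (rule exec_elims)
  from Seq.IH(1)[OF 1] Seq.IH(2)[of u2 R2 M2] 2 u show ?case by simp
next
  case (IfTrue b R c1 M t R1 M1 c2)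
  from IfTrue.prems obtain u' where "u = Suc u'" "exec w I c1 R M u' R2 M2"
    by (rule exec_elims) (use IfTrue.hyps in simp_all)
  with IfTrue.IH[of u' R2 M2] show ?case by simp
next
  case (IfFalse b R c2 M t R1 M1 c1)
  from IfFalse.prems obtain u' where "u = Suc u'" "exec w I c2 R M u' R2 M2"
    by (rule exec_elims) (use IfFalse.hyps in simp_all)
  with IfFalse.IH[of u' R2 M2] show ?case by simp
next
  case (WhileFalse b R c M)
  from WhileFalse.prems show ?case
    by (rule exec_WhileE) (use WhileFalse.hyps in simp_all)
next
  case (WhileTrue b R c M t1 R1 M1 t2 R2' M2')
  from WhileTrue.prems obtain u1 u2 S N where u: "u = Suc (u1 + u2)"
    and 1: "exec w I c R M u1 S N" and 2: "exec w I (While b c) S N u2 R2 M2"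
    by (rule exec_WhileE) (use WhileTrue.hyps in simp_all)
  from WhileTrue.IH(1)[OF 1] WhileTrue.IH(2)[of u2 R2 M2] 2 u show ?case by simp
qed (erule exec_elims; simp)+

definition words :: "nat \<Rightarrow> nat list \<Rightarrow> bool" where
  "words w xs \<longleftrightarrow> (\<forall>x\<in>set xs. x < 2 ^ w)"

text \<open>Every character, every position and the length of the string fit into a machine word.\<close>

definition string_fits :: "nat \<Rightarrow> nat list \<Rightarrow> bool" where
  "string_fits w S \<longleftrightarrow> words w S \<and> length S < 2 ^ w"

definition memory_ok :: "nat \<Rightarrow> memory \<Rightarrow> bool" where
  "memory_ok w M \<longleftrightarrow> finite {k. M k \<noteq> []} \<and> (\<forall>k. words w (M k))"

definition space :: "memory \<Rightarrow> nat" where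
  "space M = (\<Sum>k | M k \<noteq> []. length (M k))"

definition query_regs :: "nat \<Rightarrow> nat \<Rightarrow> regs" where
  "query_regs i j = (\<lambda>_. 0)(0 := i, 1 := j)"

text \<open>
  \<open>D\<close> is the memory produced by preprocessing and \<open>Q\<close> the query program; a query \<open>(i, j)\<close> is passed
  in registers 0 and 1 and its result is returned in register 0. The memory comprises the data
  structure together with the working memory of queries, both counted by \<open>space\<close>. Queries may
  modify it; the set \<open>Inv\<close> of memory states closed under queries expresses that every query in an
  arbitrary sequence of queries, beginning in \<open>D\<close>, is answered correctly and within the time bound.
\<close>

definition data_structure ::
  "nat \<Rightarrow> nat list list \<Rightarrow> prog \<Rightarrow> memory \<Rightarrow> (nat \<times> nat) set \<Rightarrow> (nat \<Rightarrow> nat \<Rightarrow> nat) \<Rightarrow> real \<Rightarrow> real \<Rightarrow> bool"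
where
  "data_structure w I Q D queries answer sp time \<longleftrightarrow>
    (\<exists>Inv. D \<in> Inv \<and>
      (\<forall>M\<in>Inv. memory_ok w M \<and> real (space M) \<le> sp \<and>
        (\<forall>(i, j)\<in>queries. \<exists>t R' M'. exec w I Q (query_regs i j) M t R' M' \<and>
           real t \<le> time \<and> R' 0 = answer i j \<and> M' \<in> Inv)))"

text \<open>Positions are numbered from 0.\<close>

definition solves_LCE1 :: "nat \<Rightarrow> nat list \<Rightarrow> prog \<Rightarrow> memory \<Rightarrow> real \<Rightarrow> real \<Rightarrow> bool" where
  "solves_LCE1 w P Q D sp time \<longleftrightarrow>
    data_structure w [P] Q D ({..<length P} \<times> {..<length P}) (LCE1 P) sp time"

definition solves_LCE2 :: "nat \<Rightarrow> nat list \<Rightarrow> nat list \<Rightarrow> prog \<Rightarrow> memory \<Rightarrow> real \<Rightarrow> real \<Rightarrow> bool" where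
  "solves_LCE2 w P T Q D sp time \<longleftrightarrow>
    data_structure w [P, T] Q D ({..<length P} \<times> {..<length T}) (LCE2 P T) sp time"

end

theory Submission
  imports Defs
begin

text \<open>
  Sample every \<open>\<tau>\<close>-th position \<open>j\<close> of \<open>T\<close> and store a position \<open>p\<close> of \<open>P\<close> that maximises
  \<open>L = LCE2 P T p j\<close>, together with \<open>L\<close>. By the ultrametric inequality for common prefixes and the
  maximality of \<open>p\<close>, \<open>LCE2 P T i j = min (LCE1 P i p) L\<close> for every position \<open>i\<close> of \<open>P\<close>. A query
  compares characters directly until it is decided or reaches a sampled position, which takes
  fewer than \<open>\<tau>\<close> comparisons, and then asks a single query on \<open>P\<close>. The given query program is run
  unchanged; the additional registers and arrays are numbered above all those that it mentions.
\<close>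

section \<open>Common extensions\<close>

lemma LCE2_rec:
  "LCE2 P T i j =
    (if i < length P \<and> j < length T \<and> P ! i = T ! j then Suc (LCE2 P T (Suc i) (Suc j)) else 0)"
proof (cases "i < length P \<and> j < length T")
  case True
  then have "drop i P = P ! i # drop (Suc i) P" "drop j T = T ! j # drop (Suc j) T"
    by (simp_all add: Cons_nth_drop_Suc)
  with True show ?thesis by (simp add: LCE2_def)
next
  case False
  then have "drop i P = [] \<or> drop j T = []" by auto
  with False show ?thesis by (cases "drop i P") (auto simp: LCE2_def)
qed

lemma LCE2_le_length: "LCE2 P T i j \<le> length T"
proof -
  have "length (longest_common_prefix xs ys) \<le> length ys" for xs ys :: "'a list"
    by (simp add: longest_common_prefix_prefix2 prefix_length_le)
  from this[of "drop i P" "drop j T"] show ?thesis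
    by (simp add: LCE2_def)
qed

lemma longest_common_prefix_commute:
  "longest_common_prefix xs ys = longest_common_prefix ys xs"
  by (induction xs ys rule: longest_common_prefix.induct) auto

text \<open>Of the two common prefixes with \<open>ys\<close>, the shorter is a prefix of the
  longer, hence of both \<open>xs\<close> and \<open>zs\<close>.\<close>

lemma longest_common_prefix_ultrametric:
  "min (length (longest_common_prefix xs ys)) (length (longest_common_prefix ys zs))
     \<le> length (longest_common_prefix xs zs)"
proof (induction xs ys arbitrary: zs rule: longest_common_prefix.induct)
  case (1 x xs y ys)
  then show ?case by (cases zs) auto
qed auto

text \<open>The ultrametric inequality through \<open>drop p P\<close> gives \<ge>. Through
  \<open>drop j T\<close> it bounds \<open>min (LCE2 P T i j) (LCE2 P T p j)\<close> by
  \<open>LCE1 P i p\<close>, and by assumption that minimum is \<open>LCE2 P T i j\<close>.\<close>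

lemma LCE2_eq_min_LCE1:
  assumes "LCE2 P T i j \<le> LCE2 P T p j"
  shows "LCE2 P T i j = min (LCE1 P i p) (LCE2 P T p j)"
  using assms longest_common_prefix_ultrametric[of "drop i P" "drop p P" "drop j T"]
    longest_common_prefix_ultrametric[of "drop i P" "drop j T" "drop p P"]
    longest_common_prefix_commute[of "drop p P" "drop j T"]
  by (simp add: LCE1_def LCE2_def)

text \<open>The default 0 for empty \<open>P\<close> keeps the table entry a machine word; no query
  is asked in that case.\<close>

lemma LCE2_maximal_position:
  "\<exists>p. (p < length P \<or> p = 0) \<and> (\<forall>i<length P. LCE2 P T i j \<le> LCE2 P T p j)"
proof (cases "P = []")
  case False
  let ?A = "(\<lambda>i. LCE2 P T i j) ` {..<length P}"
  have "Max ?A \<in> ?A" using False by (intro Max_in) auto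
  then obtain p where p: "p < length P" "Max ?A = LCE2 P T p j" by auto
  have "LCE2 P T i j \<le> Max ?A" if "i < length P" for i
    using that by (intro Max_ge) auto
  with p show ?thesis by auto
qed auto

section \<open>Programs and their frames\<close>

text \<open>A combined state, for registers and memory alike: the part below \<open>b\<close>
  belongs to the given program, the rest to the extension.\<close>

definition splice_below :: "nat \<Rightarrow> (nat \<Rightarrow> 'a) \<Rightarrow> (nat \<Rightarrow> 'a) \<Rightarrow> nat \<Rightarrow> 'a" where
  "splice_below b f g = (\<lambda>x. if x < b then f x else g x)"

lemma splice_below_apply [simp]:
  "x < b \<Longrightarrow> splice_below b f g x = f x"
  "b \<le> x \<Longrightarrow> splice_below b f g x = g x"
  by (simp_all add: splice_below_def)

lemma splice_below_fun_upd [simp]: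
  "r < b \<Longrightarrow> splice_below b (f(r := v)) g = (splice_below b f g)(r := v)"
  by (auto simp: splice_below_def)

fun test_bound :: "test \<Rightarrow> nat" where
  "test_bound (Less a b) = Suc (max a b)"
| "test_bound (Equal a b) = Suc (max a b)"

text \<open>An exclusive bound on register and array numbers. Literals need no bound, nor do the
  numbers of input strings: new strings are appended after the old ones.\<close>

fun prog_bound :: "prog \<Rightarrow> nat" where
  "prog_bound Skip = 0"
| "prog_bound (Const r c) = Suc r"
| "prog_bound (Move r a) = Suc (max r a)"
| "prog_bound (Binop r f a b) = Suc (max r (max a b))"
| "prog_bound (InputLength r k) = Suc r"
| "prog_bound (Input r k a) = Suc (max r a)"
| "prog_bound (Load r k a) = Suc (max r (max k a))"
| "prog_bound (Store k a r) = Suc (max r (max k a))"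
| "prog_bound (Seq c d) = max (prog_bound c) (prog_bound d)"
| "prog_bound (If t c d) = max (test_bound t) (max (prog_bound c) (prog_bound d))"
| "prog_bound (While t c) = max (test_bound t) (prog_bound c)"

lemma eval_test_splice_below [simp]:
  "test_bound t \<le> b \<Longrightarrow> eval_test t (splice_below b R S) = eval_test t R"
  by (cases t) auto

text \<open>All registers and arrays that \<open>c\<close> mentions lie below \<open>b\<close>, and
  appending strings does not renumber the existing ones, so the same run goes through with the same
  step count.\<close>

lemma exec_frame:
  assumes "exec w I c R M t R' M'" and "prog_bound c \<le> b"
  shows "exec w (I @ J) c (splice_below b R S) (splice_below b M N) t
           (splice_below b R' S) (splice_below b M' N)"
  using assms
proof (induction rule: exec.induct)
  case (Binop r f x y R M)
  then show ?case
    using exec.Binop[of w "I @ J" r f x y "splice_below b R S" "splice_below b M N"]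
    by (simp add: Suc_le_eq del: fun_upd_apply)
next
  case (Move r a R M)
  then show ?case
    using exec.Move[of w "I @ J" r a "splice_below b R S" "splice_below b M N"]
    by (simp add: Suc_le_eq del: fun_upd_apply)
next
  case (InputLength k r R M)
  then show ?case
    using exec.InputLength[of k "I @ J" w r "splice_below b R S" "splice_below b M N"]
    by (simp add: nth_append Suc_le_eq del: fun_upd_apply)
next
  case (Input k R a r M)
  then show ?case
    using exec.Input[of k "I @ J" "splice_below b R S" a w r "splice_below b M N"]
    by (simp add: nth_append Suc_le_eq del: fun_upd_apply)
next
  case (Load R a M k r)
  then show ?case
    using exec.Load[of "splice_below b R S" a "splice_below b M N" k w "I @ J" r]
    by (simp add: Suc_le_eq del: fun_upd_apply)
next
  case (Store R a M k r)
  then show ?case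
    using exec.Store[of "splice_below b R S" a "splice_below b M N" k w "I @ J" r]
    by (simp add: Suc_le_eq del: fun_upd_apply)
next
  case (WhileTrue t R c M t1 R1 M1 t2 R2 M2)
  then show ?case by (intro exec.WhileTrue) auto
qed (auto intro: exec.intros simp: Suc_le_eq simp del: fun_upd_apply One_nat_def)

section \<open>Total correctness with step counts\<close>

text \<open>Existence of one run suffices, since execution is deterministic.\<close>

definition wp ::
  "nat \<Rightarrow> nat list list \<Rightarrow> prog \<Rightarrow> regs \<Rightarrow> memory \<Rightarrow> (nat \<Rightarrow> regs \<Rightarrow> memory \<Rightarrow> bool) \<Rightarrow> bool" where
  "wp w I c R M post \<longleftrightarrow> (\<exists>t R' M'. exec w I c R M t R' M' \<and> post t R' M')"

lemma wp_exec: "exec w I c R M t R' M' \<Longrightarrow> post t R' M' \<Longrightarrow> wp w I c R M post"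
  by (auto simp: wp_def)

lemma wp_mono:
  "wp w I c R M post \<Longrightarrow> (\<And>t R' M'. post t R' M' \<Longrightarrow> post' t R' M') \<Longrightarrow> wp w I c R M post'"
  unfolding wp_def by blast

text \<open>Stated as equations so that rewriting executes loop-free code symbolically and leaves
  the bounds checks as goals.\<close>

lemma wp_simps:
  "wp w I (Const r v) R M post = post 1 (R(r := take_bit w v)) M"
  "wp w I (Move r a) R M post = post 1 (R(r := R a)) M"
  "wp w I (Binop r f a b) R M post = post 1 (R(r := eval_binop w f (R a) (R b))) M"
  "wp w I (InputLength r k) R M post =
    (k < length I \<and> post 1 (R(r := length (I ! k))) M)"
  "wp w I (Input r k a) R M post =
    (k < length I \<and> R a < length (I ! k) \<and> post 1 (R(r := I ! k ! R a)) M)"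
  "wp w I (Load r k a) R M post = (R a < length (M k) \<and> post 1 (R(r := M k ! R a)) M)"
  "wp w I (Seq c d) R M post =
    wp w I c R M (\<lambda>t R' M'. wp w I d R' M' (\<lambda>u. post (t + u)))"
  "wp w I (If test c d) R M post =
    (if eval_test test R then wp w I c R M (\<lambda>t. post (Suc t)) else wp w I d R M (\<lambda>t. post (Suc t)))"
  by (auto simp: wp_def simp del: One_nat_def intro: exec.intros elim!: exec_elims)
    (simp | blast)+

lemmas wp_Seq = wp_simps(7)

lemma wp_While_stop: "\<not> eval_test b R \<Longrightarrow> post 1 R M \<Longrightarrow> wp w I (While b c) R M post"
  by (rule wp_exec[OF exec.WhileFalse])

lemma wp_While_step:
  "eval_test b R \<Longrightarrow>
    wp w I c R M (\<lambda>t R' M'. wp w I (While b c) R' M' (\<lambda>u. post (Suc (t + u)))) \<Longrightarrow>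
    wp w I (While b c) R M post"
  unfolding wp_def by (blast intro: exec.intros)

section \<open>The query program\<close>

text \<open>
  Registers, relative to \<open>b\<close>: 0 and 1 the current positions in \<open>P\<close> and \<open>T\<close>, 2 the number of matched
  characters, 3 the value \<open>\<tau>\<close>, 4 and 5 the lengths of \<open>P\<close> and \<open>T\<close>, 6 and 7 the constants one and
  zero, 8 and 9 flags for the end of the scan and for having reached a sampled position, 10 and 11
  scratch. The literal 2 is avoided since it is not a word if \<open>w = 1\<close>. Array \<open>b\<close> holds \<open>\<tau>\<close>, and
  arrays \<open>b + 1\<close> and \<open>b + 2\<close> hold the sampled maximising positions and their extensions.
\<close>

definition scan_step :: "nat \<Rightarrow> prog" where
  "scan_step b =
    If (Less b (b + 4))
      (If (Less (b + 1) (b + 5))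
        (Seq (Binop (b + 10) Mod (b + 1) (b + 3))
          (If (Equal (b + 10) (b + 7))
            (Seq (Move (b + 8) (b + 6)) (Move (b + 9) (b + 6)))
            (Seq (Input (b + 10) 0 b)
            (Seq (Input (b + 11) 1 (b + 1))
              (If (Equal (b + 10) (b + 11))
                (Seq (Binop b Add b (b + 6))
                (Seq (Binop (b + 1) Add (b + 1) (b + 6))
                     (Binop (b + 2) Add (b + 2) (b + 6))))
                (Move (b + 8) (b + 6)))))))
        (Move (b + 8) (b + 6)))
      (Move (b + 8) (b + 6))"

definition scan :: "nat \<Rightarrow> prog" where
  "scan b = While (Equal (b + 8) (b + 7)) (scan_step b)"

text \<open>Registers 0 and 1 are set up as the arguments of \<open>Q\<close>; the closing test
  takes the minimum of its answer and the stored extension.\<close>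

definition sampled_query :: "nat \<Rightarrow> prog \<Rightarrow> prog" where
  "sampled_query b Q =
    Seq (Binop (b + 10) Div (b + 1) (b + 3))
   (Seq (Load 1 (b + 1) (b + 10))
   (Seq (Load (b + 11) (b + 2) (b + 10))
   (Seq (Move 0 b)
   (Seq Q
        (If (Less 0 (b + 11))
          (Binop 0 Add (b + 2) 0)
          (Binop 0 Add (b + 2) (b + 11)))))))"

text \<open>Register \<open>b + 7\<close> is never written: for \<open>2 \<le> b\<close> it still
  holds the zero with which a query starts.\<close>

definition init_query :: "nat \<Rightarrow> prog" where
  "init_query b =
    Seq (Move b 0)
   (Seq (Move (b + 1) 1)
   (Seq (Load (b + 3) b (b + 7))
   (Seq (InputLength (b + 4) 0)
   (Seq (InputLength (b + 5) 1)
        (Const (b + 6) 1)))))"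

definition query2 :: "nat \<Rightarrow> prog \<Rightarrow> prog" where
  "query2 b Q =
    Seq (init_query b)
   (Seq (scan b)
        (If (Equal (b + 9) (b + 6)) (sampled_query b Q) (Move 0 (b + 2))))"

section \<open>Invariant and cost of the scan\<close>

text \<open>The loop invariant. Positions may equal the lengths, as a scan can run off the end of a
  string.\<close>

definition scan_ok :: "nat \<Rightarrow> nat list \<Rightarrow> nat list \<Rightarrow> nat \<Rightarrow> nat \<Rightarrow> regs \<Rightarrow> bool" where
  "scan_ok b P T \<tau> ans R \<longleftrightarrow>
    R b \<le> length P \<and> R (b + 1) \<le> length T \<and> R (b + 2) + LCE2 P T (R b) (R (b + 1)) = ans \<and>
    R (b + 3) = \<tau> \<and> R (b + 4) = length P \<and> R (b + 5) = length T \<and>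
    R (b + 6) = 1 \<and> R (b + 7) = 0"

text \<open>A halt at a sampled position must leave both positions in range, so that a query on
  \<open>P\<close> is legal. Any other halt is at a mismatch or an end, where nothing remains to be
  matched.\<close>

definition scan_done :: "nat \<Rightarrow> nat list \<Rightarrow> nat list \<Rightarrow> nat \<Rightarrow> nat \<Rightarrow> regs \<Rightarrow> bool" where
  "scan_done b P T \<tau> ans R \<longleftrightarrow> scan_ok b P T \<tau> ans R \<and>
    (if R (b + 9) = 1 then R b < length P \<and> R (b + 1) < length T \<and> \<tau> dvd R (b + 1)
     else R (b + 2) = ans)"

text \<open>The bound 10 is attained on a match: four tests, one \<open>Mod\<close>, two reads and
  three additions.\<close>

lemma scan_step_correct:
  assumes "string_fits w P" "string_fits w T" "ans \<le> length T"
    and "scan_ok b P T \<tau> ans R" "R (b + 8) = 0" "R (b + 9) = 0"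
  shows "wp w [P, T] (scan_step b) R M (\<lambda>t R' M'. t \<le> 10 \<and> M' = M \<and> (\<forall>x<b. R' x = R x) \<and>
    (if R' (b + 8) = 0
     then R' (b + 9) = 0 \<and> scan_ok b P T \<tau> ans R' \<and> R' (b + 1) = Suc (R (b + 1)) \<and>
       \<not> \<tau> dvd R (b + 1)
     else scan_done b P T \<tau> ans R'))"
proof -
  have lens: "length P < 2 ^ w" "length T < 2 ^ w"
    using assms by (auto simp: string_fits_def)
  have R: "R b \<le> length P" "R (Suc b) \<le> length T"
    "R (b + 2) + LCE2 P T (R b) (R (Suc b)) = ans"
    "R (b + 3) = \<tau>" "R (b + 4) = length P" "R (b + 5) = length T"
    "R (b + 6) = 1" "R (b + 7) = 0"
    using assms(4) by (simp_all add: scan_ok_def)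
  have mod_word: "take_bit w (R (Suc b) mod \<tau>) = R (Suc b) mod \<tau>"
    using R(2) lens(2) mod_less_eq_dividend[of "R (Suc b)" \<tau>]
    by (intro take_bit_nat_eq_self) linarith
  show ?thesis
  proof (cases "R b < length P \<and> R (Suc b) < length T")
    case False
    then have "LCE2 P T (R b) (R (Suc b)) = 0" by (subst LCE2_rec) auto
    with False R assms(5,6) show ?thesis
      by (auto simp: scan_step_def wp_simps scan_done_def scan_ok_def)
  next
    case inside: True
    show ?thesis
    proof (cases "\<tau> dvd R (Suc b)")
      case True
      with inside R assms(5,6) mod_word show ?thesis
        by (auto simp: scan_step_def wp_simps scan_done_def scan_ok_def dvd_eq_mod_eq_0)
    next
      case unsampled: False
      show ?thesis
      proof (cases "P ! R b = T ! R (Suc b)")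
        case True
        with inside have "LCE2 P T (R b) (R (Suc b)) = Suc (LCE2 P T (Suc (R b)) (Suc (R (Suc b))))"
          by (subst LCE2_rec) auto
        \<comment> \<open>The incremented counter is still at most \<open>ans\<close>, so it fits
          into a word and the addition does not wrap around.\<close>
        moreover from this R(3) assms(3) have "Suc (R (b + 2)) \<le> length T"
          by simp
        then have "take_bit w (Suc (R b)) = Suc (R b)"
          "take_bit w (Suc (R (Suc b))) = Suc (R (Suc b))"
          "take_bit w (Suc (R (b + 2))) = Suc (R (b + 2))"
          using inside lens by (auto intro!: take_bit_nat_eq_self)
        ultimately show ?thesis
          using True inside unsampled R assms(5,6) mod_word
          by (auto simp: scan_step_def wp_simps scan_done_def scan_ok_def dvd_eq_mod_eq_0)
      next
        case False
        then have "LCE2 P T (R b) (R (Suc b)) = 0" by (subst LCE2_rec) auto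
        with False inside unsampled R assms(5,6) mod_word show ?thesis
          by (auto simp: scan_step_def wp_simps scan_done_def scan_ok_def dvd_eq_mod_eq_0)
      qed
    qed
  qed
qed

text \<open>\<open>d\<close> is the distance from the position in \<open>T\<close> to some multiple
  of \<open>\<tau>\<close>; it drops by one in each iteration that continues. An iteration costs at
  most 10 steps and a loop test; the last one is followed by a failing test.\<close>

lemma scan_correct:
  assumes "string_fits w P" "string_fits w T" "ans \<le> length T"
    and "scan_ok b P T \<tau> ans R" "R (b + 8) = 0" "R (b + 9) = 0" "\<tau> dvd R (b + 1) + d"
  shows "wp w [P, T] (scan b) R M (\<lambda>t R' M'. t \<le> 12 * d + 12 \<and> M' = M \<and>
    (\<forall>x<b. R' x = R x) \<and> scan_done b P T \<tau> ans R')"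
  using assms(4-)
proof (induction d arbitrary: R)
  case (0 R)
  show ?case
    unfolding scan_def
  proof (rule wp_While_step)
    show "eval_test (Equal (b + 8) (b + 7)) R"
      using 0 by (simp add: scan_ok_def)
    \<comment> \<open>At distance 0 the position is a multiple of \<open>\<tau>\<close>, so the
      outcome in which the scan continues is contradictory.\<close>
    show "wp w [P, T] (scan_step b) R M (\<lambda>t R' M'.
      wp w [P, T] (While (Equal (b + 8) (b + 7)) (scan_step b)) R' M' (\<lambda>u R'' M''.
        Suc (t + u) \<le> 12 * 0 + 12 \<and> M'' = M \<and>
        (\<forall>x<b. R'' x = R x) \<and> scan_done b P T \<tau> ans R''))"
      using 0 by (intro wp_mono[OF scan_step_correct[OF assms(1-3) 0(1-3)]] wp_While_stop)
        (auto simp: scan_done_def scan_ok_def split: if_splits)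
  qed
next
  case (Suc d R)
  show ?case
    unfolding scan_def
  proof (rule wp_While_step)
    show "eval_test (Equal (b + 8) (b + 7)) R"
      using Suc.prems by (simp add: scan_ok_def)
    have "wp w [P, T] (While (Equal (b + 8) (b + 7)) (scan_step b)) R' M' (\<lambda>u R'' M''.
        Suc (t + u) \<le> 12 * Suc d + 12 \<and> M'' = M \<and>
        (\<forall>x<b. R'' x = R x) \<and> scan_done b P T \<tau> ans R'')"
      if step: "t \<le> 10 \<and> M' = M \<and> (\<forall>x<b. R' x = R x) \<and>
        (if R' (b + 8) = 0
         then R' (b + 9) = 0 \<and> scan_ok b P T \<tau> ans R' \<and> R' (b + 1) = Suc (R (b + 1)) \<and>
           \<not> \<tau> dvd R (b + 1)
         else scan_done b P T \<tau> ans R')" for t R' M'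
    proof (cases "R' (b + 8) = 0")
      case True
      then have "wp w [P, T] (scan b) R' M (\<lambda>t R'' M'. t \<le> 12 * d + 12 \<and> M' = M \<and>
          (\<forall>x<b. R'' x = R' x) \<and> scan_done b P T \<tau> ans R'')"
        using step Suc.prems(4) by (intro Suc.IH) auto
      then show ?thesis
        unfolding scan_def using step by (auto elim!: wp_mono)
    next
      case False
      with step show ?thesis
        by (intro wp_While_stop) (auto simp: scan_done_def scan_ok_def)
    qed
    then show "wp w [P, T] (scan_step b) R M (\<lambda>t R' M'.
      wp w [P, T] (While (Equal (b + 8) (b + 7)) (scan_step b)) R' M' (\<lambda>u R'' M''.
        Suc (t + u) \<le> 12 * Suc d + 12 \<and> M'' = M \<and>
        (\<forall>x<b. R'' x = R x) \<and> scan_done b P T \<tau> ans R''))"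
      by (rule wp_mono[OF scan_step_correct[OF assms(1-3) Suc.prems(1-3)]])
  qed
qed

section \<open>Sample tables and the complete query\<close>

text \<open>\<open>\<tau>\<close> itself is stored because one query program has to serve every
  \<open>\<tau>\<close>.\<close>

definition samples :: "nat \<Rightarrow> nat list \<Rightarrow> nat list \<Rightarrow> nat \<Rightarrow> (nat \<Rightarrow> nat) \<Rightarrow> memory" where
  "samples b P T \<tau> p = (\<lambda>_. [])
    (b := [\<tau>],
     b + 1 := map (\<lambda>k. p (k * \<tau>)) [0..<Suc (length T div \<tau>)],
     b + 2 := map (\<lambda>k. LCE2 P T (p (k * \<tau>)) (k * \<tau>)) [0..<Suc (length T div \<tau>)])"

lemma sampled_query_correct:
  assumes "string_fits w P" "string_fits w T" "ans \<le> length T"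
    and "prog_bound Q \<le> b" "2 \<le> b"
    and p: "\<And>j. p j < length P" "\<And>i j. i < length P \<Longrightarrow> LCE2 P T i j \<le> LCE2 P T (p j) j"
    and fin: "scan_done b P T \<tau> ans R" "R (b + 9) = 1" "\<forall>x. 2 \<le> x \<and> x < b \<longrightarrow> R x = 0"
    and Q: "\<And>i j. i < length P \<Longrightarrow> j < length P \<Longrightarrow>
      \<exists>t R' M'. exec w [P] Q (query_regs i j) M t R' M' \<and>
        t \<le> q \<and> R' 0 = LCE1 P i j \<and> M' \<in> Inv"
  shows "wp w [P, T] (sampled_query b Q) R (splice_below b M (samples b P T \<tau> p))
    (\<lambda>t R' N. t \<le> q + 6 \<and> R' 0 = ans \<and> (\<exists>M'\<in>Inv. N = splice_below b M' (samples b P T \<tau> p)))"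
proof -
  let ?N = "samples b P T \<tau> p"
  define i j k where "i = R b" and "j = R (Suc b)" and "k = R (b + 2)"
  define L where "L = LCE2 P T (p j) j"
  have R: "R b = i" "R (Suc b) = j" "R (b + 2) = k" "R (b + 3) = \<tau>"
    and i: "i < length P" and j: "j < length T" and dvd: "\<tau> dvd j"
    and ans: "k + LCE2 P T i j = ans"
    using fin(1,2) by (auto simp: scan_done_def scan_ok_def i_def j_def k_def)
  have lens: "length P < 2 ^ w" "length T < 2 ^ w"
    using assms by (auto simp: string_fits_def)
  have idx: "take_bit w (j div \<tau>) = j div \<tau>"
    using j lens(2) div_le_dividend[of j \<tau>] by (intro take_bit_nat_eq_self) linarith
  \<comment> \<open>As \<open>\<tau>\<close> divides \<open>j\<close>, entry
    \<open>j div \<tau>\<close> was computed for \<open>j\<close> itself.\<close>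
  have loads: "?N (Suc b) ! (j div \<tau>) = p j" "?N (b + 2) ! (j div \<tau>) = L"
    "j div \<tau> < length (?N (Suc b))" "j div \<tau> < length (?N (b + 2))"
    using j dvd div_le_mono[of j "length T" \<tau>]
    by (simp_all add: samples_def L_def del: upt_Suc)
  obtain t R' M' where run: "exec w [P] Q (query_regs i (p j)) M t R' M'"
    and t: "t \<le> q" and R': "R' 0 = LCE1 P i (p j)" and M': "M' \<in> Inv"
    using Q[OF i p(1)] by blast
  have LCE2: "LCE2 P T i j = min (LCE1 P i (p j)) L"
    unfolding L_def by (intro LCE2_eq_min_LCE1 p(2) i)
  define S where "S = R(b + 10 := j div \<tau>, Suc 0 := p j, b + 11 := L, 0 := i)"
  \<comment> \<open>Below \<open>b\<close>, \<open>S\<close> looks like a fresh query on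
    \<open>P\<close>, since the other low registers are still zero. Hence the run of
    \<open>Q\<close> on \<open>P\<close> alone transfers.\<close>
  have S: "splice_below b (query_regs i (p j)) S = S"
    using fin(3) \<open>2 \<le> b\<close> by (auto simp: splice_below_def query_regs_def S_def fun_eq_iff)
  have "exec w [P, T] Q S (splice_below b M ?N) t
      (splice_below b R' S) (splice_below b M' ?N)"
    using exec_frame[OF run \<open>prog_bound Q \<le> b\<close>, of "[T]" S ?N] by (simp add: S)
  note Q_run = wp_exec[OF this]
  have word: "take_bit w (k + LCE2 P T i j) = ans"
    using ans assms(3) lens(2) by (intro trans[OF take_bit_nat_eq_self]) auto
  show ?thesis
    unfolding sampled_query_def wp_simps
    using R idx loads \<open>2 \<le> b\<close> R' LCE2 word t M'
    by (simp, fold S_def, intro Q_run) (auto simp: S_def min_def split: if_splits)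
qed

text \<open>Cost: 6 steps to initialise, at most \<open>12 * \<tau> + 12\<close> to scan and at most
  \<open>q + 7\<close> to finish.\<close>

lemma query2_correct:
  assumes "string_fits w P" "string_fits w T" "0 < \<tau>" "\<tau> \<le> length T"
    and "prog_bound Q \<le> b" "2 \<le> b" and i: "i < length P" and j: "j < length T"
    and p: "\<And>j. p j < length P" "\<And>i j. i < length P \<Longrightarrow> LCE2 P T i j \<le> LCE2 P T (p j) j"
    and Q: "\<And>i j. i < length P \<Longrightarrow> j < length P \<Longrightarrow>
      \<exists>t R' M'. exec w [P] Q (query_regs i j) M t R' M' \<and>
        t \<le> q \<and> R' 0 = LCE1 P i j \<and> M' \<in> Inv"
    and "M \<in> Inv"
  shows "wp w [P, T] (query2 b Q) (query_regs i j) (splice_below b M (samples b P T \<tau> p))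
    (\<lambda>t R' N. t \<le> 12 * \<tau> + q + 25 \<and> R' 0 = LCE2 P T i j \<and>
      (\<exists>M'\<in>Inv. N = splice_below b M' (samples b P T \<tau> p)))"
proof -
  let ?N = "splice_below b M (samples b P T \<tau> p)"
  let ?ans = "LCE2 P T i j"
  define R where "R = (query_regs i j)(b := i, Suc b := j, b + 3 := \<tau>, b + 4 := length P,
    b + 5 := length T, b + 6 := 1)"
  \<comment> \<open>The word size is positive, because
    \<open>1 \<le> length T < 2 ^ w\<close>.\<close>
  have one: "take_bit w (Suc 0) = Suc 0"
    using assms(2-4) by (intro take_bit_nat_eq_self) (auto simp: string_fits_def)
  have R: "scan_ok b P T \<tau> ?ans R" "R (b + 8) = 0" "R (b + 9) = 0" "R (b + 1) = j"
    "\<And>x. 2 \<le> x \<Longrightarrow> x < b \<Longrightarrow> R x = 0"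
    using i j \<open>2 \<le> b\<close> by (auto simp: R_def scan_ok_def query_regs_def)
  have init: "wp w [P, T] (init_query b) (query_regs i j) ?N (\<lambda>t R' M'. t = 6 \<and> R' = R \<and> M' = ?N)"
    using \<open>2 \<le> b\<close> one
    by (simp add: init_query_def wp_simps R_def query_regs_def samples_def)
  \<comment> \<open>If \<open>j\<close> is itself a multiple, this distance is \<open>\<tau>\<close>
    instead of 0, which only weakens the time bound.\<close>
  have "j + (\<tau> - j mod \<tau>) = \<tau> * Suc (j div \<tau>)"
    using mult_div_mod_eq[of \<tau> j] mod_less_divisor[OF \<open>0 < \<tau>\<close>, of j]
    unfolding mult_Suc_right by linarith
  then have dvd: "\<tau> dvd R (b + 1) + (\<tau> - j mod \<tau>)"
    unfolding R(4) by (metis dvd_triv_left)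
  note scan = scan_correct[OF assms(1,2) LCE2_le_length R(1-3) dvd, of ?N]
  have final: "wp w [P, T]
      (If (Equal (b + 9) (b + 6)) (sampled_query b Q) (Move 0 (b + 2))) R' ?N
      (\<lambda>t R' N. t \<le> q + 7 \<and> R' 0 = ?ans \<and>
        (\<exists>M'\<in>Inv. N = splice_below b M' (samples b P T \<tau> p)))"
    if R': "\<forall>x<b. R' x = R x" "scan_done b P T \<tau> ?ans R'" for R'
  proof (cases "R' (b + 9) = 1")
    case True
    have "\<forall>x. 2 \<le> x \<and> x < b \<longrightarrow> R' x = 0" using R' R(5) by simp
    from sampled_query_correct[OF assms(1,2) LCE2_le_length assms(5,6) p R'(2) True this Q]
    show ?thesis
      using True R'(2) by (auto simp: wp_simps scan_done_def scan_ok_def elim!: wp_mono)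
  next
    case False
    with R'(2) \<open>M \<in> Inv\<close> show ?thesis
      by (auto simp: wp_simps scan_done_def scan_ok_def)
  qed
  show ?thesis
    unfolding query2_def wp_Seq
  proof (rule wp_mono[OF init], clarify, rule wp_mono[OF scan], clarify)
    fix u R'
    assume u: "u \<le> 12 * (\<tau> - j mod \<tau>) + 12"
      and "\<forall>x<b. R' x = R x" "scan_done b P T \<tau> ?ans R'"
    from final[OF this(2,3)] u
    show "wp w [P, T] (If (Equal (b + 9) (b + 6)) (sampled_query b Q) (Move 0 (b + 2))) R' ?N
      (\<lambda>v R' N. 6 + (u + v) \<le> 12 * \<tau> + q + 25 \<and> R' 0 = ?ans \<and>
        (\<exists>M'\<in>Inv. N = splice_below b M' (samples b P T \<tau> p)))"
      by (auto elim!: wp_mono)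
  qed
qed

section \<open>The data structure\<close>

lemma space_eq_sum:
  assumes "finite A" "{k. M k \<noteq> []} \<subseteq> A"
  shows "space M = (\<Sum>k\<in>A. length (M k))"
  unfolding space_def using assms by (intro sum.mono_neutral_left) auto

lemma space_splice_samples:
  assumes "finite {k. M k \<noteq> []}"
  shows "space (splice_below b M (samples b P T \<tau> p)) \<le> space M + 3 + 2 * (length T div \<tau>)"
proof -
  let ?N = "splice_below b M (samples b P T \<tau> p)"
  let ?A = "{k. M k \<noteq> []} \<inter> {..<b}" and ?B = "{b, Suc b, b + 2}"
  have "space ?N = (\<Sum>k\<in>?A \<union> ?B. length (?N k))"
    using assms by (intro space_eq_sum) (auto simp: splice_below_def samples_def)
  also have "\<dots> = (\<Sum>k\<in>?A. length (?N k)) + (\<Sum>k\<in>?B. length (?N k))"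
    using assms by (intro sum.union_disjoint) auto
  also have "(\<Sum>k\<in>?A. length (?N k)) = (\<Sum>k\<in>?A. length (M k))"
    by (intro sum.cong) auto
  \<comment> \<open>Arrays of \<open>M\<close> from \<open>b\<close> on are replaced, so
    \<open>M\<close> contributes at most its own space.\<close>
  also have "\<dots> \<le> space M"
    unfolding space_def using assms by (intro sum_mono2) auto
  also have "(\<Sum>k\<in>?B. length (?N k)) = 3 + 2 * (length T div \<tau>)"
    by (simp add: samples_def)
  finally show ?thesis by simp
qed

lemma memory_ok_splice_samples:
  assumes "memory_ok w M" "string_fits w P" "string_fits w T" "\<tau> \<le> length T"
    and p: "\<And>j. p j < length P \<or> p j = 0"
  shows "memory_ok w (splice_below b M (samples b P T \<tau> p))"
proof -
  let ?N = "splice_below b M (samples b P T \<tau> p)"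
  have "{k. ?N k \<noteq> []} \<subseteq> {k. M k \<noteq> []} \<union> {b, b + 1, b + 2}"
    by (auto simp: splice_below_def samples_def)
  then have "finite {k. ?N k \<noteq> []}"
    by (rule finite_subset) (use assms(1) in \<open>simp add: memory_ok_def\<close>)
  moreover have "p j < 2 ^ w" for j
    using p[of j] assms(2) by (auto simp: string_fits_def)
  moreover have "LCE2 P T k j < 2 ^ w" for k j
    using LCE2_le_length[of P T k j] assms(3) by (simp add: string_fits_def)
  ultimately show ?thesis
    using assms(1,3,4) by (auto simp: memory_ok_def words_def splice_below_def samples_def string_fits_def)
qed

text \<open>Queries change only the part of memory below \<open>b\<close>, so the image of the given
  invariant set under adding the samples is again closed under queries.\<close>

lemma solves_LCE2_query2:
  assumes n: "length T = n"
    and fits: "string_fits w P" "string_fits w T" and \<tau>: "1 \<le> \<tau>" "\<tau> \<le> n"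
    and b: "prog_bound Q \<le> b" "2 \<le> b"
    and Q: "solves_LCE1 w P Q D (real s) (real q)"
  shows "\<exists>D'::memory. solves_LCE2 w P T (query2 b Q) D'
    (37 * (real n / real \<tau> + real s)) (37 * (real \<tau> + real q))"
proof -
  from Q obtain Inv where D: "D \<in> Inv"
    and Inv: "\<forall>M\<in>Inv. memory_ok w M \<and> real (space M) \<le> real s \<and>
      (\<forall>(i, j)\<in>{..<length P} \<times> {..<length P}. \<exists>t R' M'.
        exec w [P] Q (query_regs i j) M t R' M' \<and>
        real t \<le> real q \<and> R' 0 = LCE1 P i j \<and> M' \<in> Inv)"
    unfolding solves_LCE1_def data_structure_def by blast
  have ok: "memory_ok w M \<and> space M \<le> s" if "M \<in> Inv" for M
    using Inv that by simp
  have run: "\<exists>t R' M'. exec w [P] Q (query_regs i j) M t R' M' \<and>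
      t \<le> q \<and> R' 0 = LCE1 P i j \<and> M' \<in> Inv"
    if "M \<in> Inv" "i < length P" "j < length P" for M i j
    using bspec[OF Inv that(1)] that(2,3) by simp
  obtain p where p: "\<And>j. p j < length P \<or> p j = 0"
    "\<And>i j. i < length P \<Longrightarrow> LCE2 P T i j \<le> LCE2 P T (p j) j"
    using LCE2_maximal_position[of P T] by metis
  let ?ext = "\<lambda>M. splice_below b M (samples b P T \<tau> p)"
  \<comment> \<open>As \<open>\<tau> \<le> n\<close>, the quotient absorbs the constant 3 of the
    space bound.\<close>
  have div: "1 \<le> real n / real \<tau>" "real (n div \<tau>) \<le> real n / real \<tau>"
    using \<tau> real_of_int_div4[of "int n" "int \<tau>"]
    by (simp_all flip: zdiv_int)
  have mem: "memory_ok w (?ext M) \<and> real (space (?ext M)) \<le> 37 * (real n / real \<tau> + real s)"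
    if "M \<in> Inv" for M
  proof
    show "memory_ok w (?ext M)"
      using ok[OF that] fits \<tau> n p(1) by (intro memory_ok_splice_samples) auto
    have "space (?ext M) \<le> s + 3 + 2 * (n div \<tau>)"
      using space_splice_samples[of M b P T \<tau> p] ok[OF that] n by (simp add: memory_ok_def)
    then have "real (space (?ext M)) \<le> real s + 3 + 2 * real (n div \<tau>)"
      by linarith
    also have "\<dots> \<le> 37 * (real n / real \<tau> + real s)"
      unfolding distrib_left using div by linarith
    finally show "real (space (?ext M)) \<le> 37 * (real n / real \<tau> + real s)" .
  qed
  have query: "\<exists>t R' N. exec w [P, T] (query2 b Q) (query_regs i j) (?ext M) t R' N \<and>
      real t \<le> 37 * (real \<tau> + real q) \<and> R' 0 = LCE2 P T i j \<and> N \<in> ?ext ` Inv"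
    if "M \<in> Inv" "i < length P" "j < length T" for M i j
  proof -
    \<comment> \<open>A query position \<open>i\<close> witnesses that \<open>P\<close> is nonempty,
      so the default 0 is a position too.\<close>
    have p1: "p j < length P" for j
      using p(1)[of j] that(2) by auto
    have "wp w [P, T] (query2 b Q) (query_regs i j) (?ext M)
      (\<lambda>t R' N. t \<le> 12 * \<tau> + q + 25 \<and> R' 0 = LCE2 P T i j \<and> (\<exists>M'\<in>Inv. N = ?ext M'))"
      using \<tau> n by (intro query2_correct fits b that p1 p(2) run) auto
    \<comment> \<open>The constant is 37 = 12 + 25, as 25 is at most
      \<open>25 * \<tau>\<close>.\<close>
    moreover have "real t \<le> 37 * (real \<tau> + real q)" if "t \<le> 12 * \<tau> + q + 25" for t
      using that \<tau> by simp
    ultimately show ?thesis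
      unfolding wp_def image_iff by blast
  qed
  have "solves_LCE2 w P T (query2 b Q) (?ext D)
      (37 * (real n / real \<tau> + real s)) (37 * (real \<tau> + real q))"
    unfolding solves_LCE2_def data_structure_def
    using D mem query by (intro exI[of _ "?ext ` Inv"]) auto
  then show ?thesis by blast
qed

theorem theorem5:
  shows "\<exists>C::real. C > 0 \<and>
    (\<forall>Q::prog. \<exists>Q'::prog.
      \<forall>(w::nat) (P::nat list) (T::nat list) (m::nat) (n::nat) (\<tau>::nat)
        (s::nat \<Rightarrow> nat) (q::nat \<Rightarrow> nat) (D::memory).
        length P = m \<longrightarrow> length T = n \<longrightarrow>
        string_fits w P \<longrightarrow> string_fits w T \<longrightarrow>
        1 \<le> \<tau> \<longrightarrow> \<tau> \<le> n \<longrightarrow>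
        solves_LCE1 w P Q D (real (s m)) (real (q m)) \<longrightarrow>
        (\<exists>D'::memory. solves_LCE2 w P T Q' D'
           (C * (real n / real \<tau> + real (s m)))
           (C * (real \<tau> + real (q m)))))"
proof (rule exI[of _ 37], intro conjI allI)
  fix Q :: prog
  show "\<exists>Q'. \<forall>w P T m n \<tau> s q D.
      length P = m \<longrightarrow> length T = n \<longrightarrow> string_fits w P \<longrightarrow> string_fits w T \<longrightarrow>
      1 \<le> \<tau> \<longrightarrow> \<tau> \<le> n \<longrightarrow> solves_LCE1 w P Q D (real (s m)) (real (q m)) \<longrightarrow>
      (\<exists>D'. solves_LCE2 w P T Q' D'
        (37 * (real n / real \<tau> + real (s m))) (37 * (real \<tau> + real (q m))))"
    \<comment> \<open>Adding 2 keeps the argument registers 0 and 1 below \<open>b\<close> even if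
      \<open>Q\<close> mentions no register.\<close>
    by (intro exI[of _ "query2 (prog_bound Q + 2) Q"] allI impI solves_LCE2_query2) simp_all
qed simp

end
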